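(* Consider the kernel version of the online learning problem described in the context (inputs $x_k$ replaced by $\phi(x_k)\in E$), with $w$ and the $\varepsilon_k$ Gaussian and the covariance of $w$ equal to $\Sigma_w=\nu I_{d_E}$, $\nu>0$. Let $\hat w_k^\circ\in E$ be the kernel version of the OLL estimate and $x\in\mathbb{R}^d$ arbitrary. (i) If $\overline Q^{(\phi)}=qI_{d_E}$ for some $q>0$, then for every $k=0,1,\dots$, $\hat w_k^\circ$ is a linear combination of $\phi(x_0),\dots,\phi(x_{k-1})$, and $(\hat w_k^\circ)'\phi(x)$ is a linear combination of $\mathcal K(x_0,x),\dots,\mathcal K(x_{k-1},x)$. (ii) If, instead, $\overline Q^{(\phi)}=\overline Q^{(\phi)}_{\mathrm{emp}}:=\frac1{l_U}\sum_{j=1}^{l_U}\phi(\tilde x_j)\phi(\tilde x_j)'$, where $l_U$ is a given positive integer and $\tilde x_1,\dots,\tilde x_{l_U}\in\mathbb{R}^d$ are given unsupervised examples, then for every $k=0,1,\dots$, $\hat w_k^\circ$ is a linear combination of $\phi(\tilde x_1),\dots,\phi(\tilde x_{l_U})$, and $(\hat w_k^\circ)'\phi(x)$ is a linear combination of $\mathcal K(\tilde x_1,x),\dots,\mathcal K(\tilde x_{l_U},x)$.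
   Context: $\phi:\mathbb{R}^d\to E$ is a (possibly nonlinear) map into a Euclidean space $E$ of dimension $d_E$ (possibly larger than $d$, or even infinite, in which case $E$ is a Hilbert space and matrices are replaced by linear operators); $I_{d_E}$ is the identity operator on $E$; a prime denotes transpose, so $a'b$ is the inner product in $E$. $\mathcal K:\mathbb{R}^d\times\mathbb{R}^d\to\mathbb{R}$ is the symmetric kernel $\mathcal K(x,z)=\phi(x)'\phi(z)$. $N\ge1$ is the horizon and $\gamma>0$. Data model: $y_k=w'\phi(x_k)+\varepsilon_k$, where $w\in E$ is random; the random variables $w,\{\phi(x_k)\},\{\varepsilon_k\}$ are mutually independent and have mean $0$; the $\varepsilon_k$ have the same variance $\sigma_\varepsilon^2>0$. The covariance operator of the inputs is $\overline Q^{(\phi)}:=\mathbb{E}\{\phi(x_k)\phi(x_k)'\}$ (the same for all $k$). Learning problem: $\hat w_0:=0$, $\hat w_{k+1}=\hat w_k+u_k$, where $u_k\in E$ is a function of the information $I_k:=\{(x_j,y_j),\ j=0,\dots,k;\ u_j,\ j=0,\dots,k-1\}$; the functional to be minimized is $\mathbb{E}\{\sum_{k=0}^{N-1}[((\hat w_k-w)'\phi(x_k))^2+\gamma u_k'u_k]+((\hat w_N-w)'\phi(x_N))^2\}$. Kernel version of the OLL estimate ($k=0,1,\dots,N$): $\hat w_0^\circ=0$, $\hat w_{k+1}^\circ=\hat w_k^\circ+L_k(\hat w_k^\circ-\hat w_k^\dagger)$, with $L_k:=-(\overline K_{k+1}+\gamma I_{d_E})^{-1}\overline K_{k+1}$,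 $\overline K_N=\overline Q^{(\phi)}$, $\overline K_k=\overline K_{k+1}-\overline K_{k+1}(\overline K_{k+1}+\gamma I_{d_E})^{-1}\overline K_{k+1}+\overline Q^{(\phi)}$. Here $\hat w_k^\dagger=\mathbb{E}\{w|I_k\}$ is the Kalman-filter estimate, given by $\hat w_{-1}^\dagger=0$, $\Sigma_{-1}=\Sigma_w$ and, with $C_k^{(\phi)}:=\phi(x_k)'$, $\Sigma_{k+1}=\Sigma_k-\Sigma_k(C_{k+1}^{(\phi)})'(C_{k+1}^{(\phi)}\Sigma_k(C_{k+1}^{(\phi)})'+\sigma_\varepsilon^2)^{-1}C_{k+1}^{(\phi)}\Sigma_k$, $H_{k+1}=\Sigma_{k+1}(C_{k+1}^{(\phi)})'(\sigma_\varepsilon^2)^{-1}$, $\hat w_{k+1}^\dagger=\hat w_k^\dagger+H_{k+1}(y_{k+1}-C_{k+1}^{(\phi)}\hat w_k^\dagger)$. "Linear combination" means with real coefficients which may depend on the realization of the data; the empty linear combination is $0$. *)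

theory Defs
  imports "HOL-Probability.Probability"
begin

section \<open>Operators\<close>

(* E is a real Hilbert space of arbitrary dimension, i.e. a type of sort {real_inner, banach};
   operators on E are bounded linear maps.  For a in E, row_op a is a' : E \<rightarrow> R and col_op a is
   a : R \<rightarrow> E, so that a b' becomes col_op a o\<^sub>L row_op b. *)

abbreviation row_op :: "'e::real_inner \<Rightarrow> 'e \<Rightarrow>\<^sub>L real"
  where "row_op a \<equiv> blinfun_inner_right a"

abbreviation col_op :: "'e::real_inner \<Rightarrow> real \<Rightarrow>\<^sub>L 'e"
  where "col_op a \<equiv> blinfun_scaleR_left a"

definition outer :: "'e::real_inner \<Rightarrow> 'e \<Rightarrow> 'e \<Rightarrow>\<^sub>L 'e"
  where "outer a b = col_op a o\<^sub>L row_op b"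

(* The two-sided inverse; unspecified if A is not invertible. *)
definition op_inv :: "('e::real_normed_vector \<Rightarrow>\<^sub>L 'e) \<Rightarrow> 'e \<Rightarrow>\<^sub>L 'e"
  where "op_inv A = (THE B. A o\<^sub>L B = id_blinfun \<and> B o\<^sub>L A = id_blinfun)"

definition feature_kernel :: "('x \<Rightarrow> 'e::real_inner) \<Rightarrow> 'x \<Rightarrow> 'x \<Rightarrow> real"
  where "feature_kernel \<phi> x z = \<phi> x \<bullet> \<phi> z"

section \<open>Random elements of E given by their scalar products\<close>

(* If E is infinite-dimensional, no E-valued random variable is centred Gaussian with covariance
   operator \<nu> I (\<nu> > 0); such a w exists only through the random variables w'a, a in E.
   Therefore the random weight is represented by Z \<omega> a = w(\<omega>)'a, where Z \<omega> is a linear functional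
   for each outcome \<omega>.  An E-valued W gives Z \<omega> a = W \<omega> \<bullet> a, and if dim E is finite every Z
   arises in this way from exactly one W with the same generated events; see the lemmas below. *)

definition scalar_events :: "'a measure \<Rightarrow> ('a \<Rightarrow> 'e \<Rightarrow> real) \<Rightarrow> 'a set set"
  where "scalar_events M Z =
    sigma_sets (space M) {(\<lambda>\<omega>. Z \<omega> a) -` A \<inter> space M | a A. A \<in> sets borel}"

definition scalar_mean_zero :: "'a measure \<Rightarrow> ('a \<Rightarrow> 'e \<Rightarrow> real) \<Rightarrow> bool"
  where "scalar_mean_zero M Z \<longleftrightarrow>
    (\<forall>a. integrable M (\<lambda>\<omega>. Z \<omega> a) \<and> (LINT \<omega>|M. Z \<omega> a) = 0)"

(* Q = E{Z Z'}, the covariance operator when Z is centred. *)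
definition has_second_moment ::
    "'a measure \<Rightarrow> ('a \<Rightarrow> 'e::real_inner \<Rightarrow> real) \<Rightarrow> ('e \<Rightarrow>\<^sub>L 'e) \<Rightarrow> bool"
  where "has_second_moment M Z Q \<longleftrightarrow>
    (\<forall>a b. integrable M (\<lambda>\<omega>. Z \<omega> a * Z \<omega> b) \<and> (LINT \<omega>|M. Z \<omega> a * Z \<omega> b) = a \<bullet> Q b)"

(* Constants count as (degenerate) Gaussian variables. *)
definition gaussian_variable :: "'a measure \<Rightarrow> ('a \<Rightarrow> real) \<Rightarrow> bool"
  where "gaussian_variable M Z \<longleftrightarrow>
    (\<exists>\<mu>. Z \<in> borel_measurable M \<and> (AE \<omega> in M. Z \<omega> = \<mu>)) \<or>
    (\<exists>\<mu> \<sigma>. \<sigma> > 0 \<and> distributed M lborel Z (normal_density \<mu> \<sigma>))"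

lemma linear_functional_euclidean:
  fixes Z :: "'a \<Rightarrow> 'e::euclidean_space \<Rightarrow> real"
  assumes "\<And>\<omega>. linear (Z \<omega>)"
  shows "\<exists>!W. Z = (\<lambda>\<omega> a. W \<omega> \<bullet> a)"
proof (rule ex1I)
  have "Z \<omega> a = (\<Sum>i\<in>Basis. Z \<omega> i *\<^sub>R i) \<bullet> a" for \<omega> a
  proof -
    interpret linear "Z \<omega>" by (rule assms)
    have "Z \<omega> a = Z \<omega> (\<Sum>i\<in>Basis. (a \<bullet> i) *\<^sub>R i)"
      by (simp add: euclidean_representation)
    also have "\<dots> = (\<Sum>i\<in>Basis. (a \<bullet> i) * Z \<omega> i)"
      by (simp add: sum scale)
    also have "\<dots> = (\<Sum>i\<in>Basis. Z \<omega> i *\<^sub>R i) \<bullet> a"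
      by (simp only: inner_sum_left inner_scaleR_left) (simp add: inner_commute mult.commute)
    finally show ?thesis .
  qed
  then show "Z = (\<lambda>\<omega> a. (\<Sum>i\<in>Basis. Z \<omega> i *\<^sub>R i) \<bullet> a)"
    by blast
next
  fix W assume "Z = (\<lambda>\<omega> a. W \<omega> \<bullet> a)"
  then show "W = (\<lambda>\<omega>. \<Sum>i\<in>Basis. Z \<omega> i *\<^sub>R i)"
    by (auto simp: euclidean_representation)
qed

lemma scalar_events_euclidean:
  fixes W :: "'a \<Rightarrow> 'e::euclidean_space"
  shows "scalar_events M (\<lambda>\<omega> a. W \<omega> \<bullet> a) = {W -` A \<inter> space M | A. A \<in> sets borel}"
    (is "?L = ?R")
proof -
  let ?V = "vimage_algebra (space M) W borel"
  let ?S = "sigma (space M) ?L"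
  have L: "?L \<subseteq> Pow (space M)"
  proof
    fix B assume "B \<in> ?L"
    then have "B \<subseteq> space M"
      unfolding scalar_events_def by (rule sigma_sets_into_sp[rotated]) auto
    then show "B \<in> Pow (space M)" by simp
  qed
  have setsS: "sets ?S = ?L"
    unfolding sets_measure_of[OF L] unfolding scalar_events_def
    by (rule sigma_sets_sigma_sets_eq) auto
  have R: "?R = sets ?V"
    by (auto simp: sets_vimage_algebra2)
  have "?L \<subseteq> sets ?V"
  proof -
    have W: "W \<in> borel_measurable ?V"
      by (rule measurable_vimage_algebra1) auto
    have "(\<lambda>\<omega>. W \<omega> \<bullet> a) -` A \<inter> space M \<in> sets ?V" if "A \<in> sets borel" for a A
      using measurable_sets[OF borel_measurable_inner[OF W borel_measurable_const[of a]] that]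
      by simp
    then have "sigma_sets (space ?V) {(\<lambda>\<omega>. W \<omega> \<bullet> a) -` A \<inter> space M | a A. A \<in> sets borel} \<subseteq> sets ?V"
      by (intro sets.sigma_sets_subset) auto
    then show ?thesis by (simp add: scalar_events_def)
  qed
  moreover have "sets ?V \<subseteq> ?L"
  proof -
    have sp: "space ?S = space M" by (rule space_measure_of[OF L])
    have "(\<lambda>\<omega>. W \<omega> \<bullet> a) \<in> borel_measurable ?S" for a
    proof (rule measurableI)
      fix A :: "real set" assume "A \<in> sets borel"
      then show "(\<lambda>\<omega>. W \<omega> \<bullet> a) -` A \<inter> space ?S \<in> sets ?S"
        unfolding setsS sp unfolding scalar_events_def by (intro sigma_sets.Basic) auto
    qed simp
    then have "W \<in> borel_measurable ?S"
      by (simp add: borel_measurable_euclidean_space[of W])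
    from measurable_sets[OF this] show ?thesis
      unfolding setsS sp R[symmetric] by blast
  qed
  ultimately show ?thesis using R by simp
qed

section \<open>The data model\<close>

datatype source = Weight | Input nat | Noise nat

locale kernel_online_learning = prob_space M
  for M :: "'a measure" +
  fixes \<phi> :: "real^'d \<Rightarrow> 'e::{real_inner, banach}"
    and x :: "nat \<Rightarrow> 'a \<Rightarrow> real^'d"
    and w :: "'a \<Rightarrow> 'e \<Rightarrow> real"
    and \<epsilon> :: "nat \<Rightarrow> 'a \<Rightarrow> real"
    and y :: "nat \<Rightarrow> 'a \<Rightarrow> real"
    and N :: nat
    and \<gamma> \<sigma>\<epsilon>2 :: real
    and \<Sigma>w Qbar :: "'e \<Rightarrow>\<^sub>L 'e"
  assumes horizon: "N \<ge> 1"
    and penalty: "\<gamma> > 0"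
    and noise_level: "\<sigma>\<epsilon>2 > 0"
    and input_measurable: "k \<le> N \<Longrightarrow> random_variable borel (x k)"
    and feature_measurable: "k \<le> N \<Longrightarrow> random_variable borel (\<lambda>\<omega>. \<phi> (x k \<omega>))"
    and noise_measurable: "k \<le> N \<Longrightarrow> random_variable borel (\<epsilon> k)"
    and weight_measurable: "random_variable borel (\<lambda>\<omega>. w \<omega> a)"
    and weight_linear: "\<omega> \<in> space M \<Longrightarrow> linear (w \<omega>)"
    and independent: "indep_sets
      (\<lambda>s. case s of
         Weight \<Rightarrow> scalar_events M w
       | Input k \<Rightarrow> {(\<lambda>\<omega>. \<phi> (x k \<omega>)) -` A \<inter> space M | A. A \<in> sets borel}
       | Noise k \<Rightarrow> {\<epsilon> k -` A \<inter> space M | A. A \<in> sets borel})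
      ({Weight} \<union> Input ` {..N} \<union> Noise ` {..N})"
    and weight_mean: "scalar_mean_zero M w"
    and weight_covariance: "has_second_moment M w \<Sigma>w"
    and feature_mean: "k \<le> N \<Longrightarrow> scalar_mean_zero M (\<lambda>\<omega> a. \<phi> (x k \<omega>) \<bullet> a)"
    and feature_covariance: "k \<le> N \<Longrightarrow> has_second_moment M (\<lambda>\<omega> a. \<phi> (x k \<omega>) \<bullet> a) Qbar"
    and noise_mean: "k \<le> N \<Longrightarrow> integrable M (\<epsilon> k) \<and> expectation (\<epsilon> k) = 0"
    and noise_variance:
      "k \<le> N \<Longrightarrow> integrable M (\<lambda>\<omega>. (\<epsilon> k \<omega>)\<^sup>2) \<and> variance (\<epsilon> k) = \<sigma>\<epsilon>2"
    and observation: "k \<le> N \<Longrightarrow> \<omega> \<in> space M \<Longrightarrow> y k \<omega> = w \<omega> (\<phi> (x k \<omega>)) + \<epsilon> k \<omega>"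

section \<open>Kalman filter\<close>

(* In this section f k stands for the realization of \<phi>(x_k) and y k for that of y_k.  The filter
   starts at index -1, so all time indices are shifted by one: kalman_cov n is \<Sigma>_{n-1} and
   kalman_state n is the estimate w^\<dagger>_{n-1}.  In the Gaussian model with \<epsilon> of variance s2
   these recursions compute E{w | \<phi>(x_j), y_j, j \<le> k}. *)

definition kalman_cov_step ::
    "real \<Rightarrow> 'e::real_inner \<Rightarrow> ('e \<Rightarrow>\<^sub>L 'e) \<Rightarrow> 'e \<Rightarrow>\<^sub>L 'e"
  where "kalman_cov_step s2 a \<Sigma> =
    \<Sigma> - inverse (row_op a (\<Sigma> (col_op a 1)) + s2) *\<^sub>R
          (\<Sigma> o\<^sub>L col_op a o\<^sub>L row_op a o\<^sub>L \<Sigma>)"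

primrec kalman_cov ::
    "('e::real_inner \<Rightarrow>\<^sub>L 'e) \<Rightarrow> real \<Rightarrow> (nat \<Rightarrow> 'e) \<Rightarrow> nat \<Rightarrow> 'e \<Rightarrow>\<^sub>L 'e"
  where
    "kalman_cov \<Sigma>w s2 f 0 = \<Sigma>w"
  | "kalman_cov \<Sigma>w s2 f (Suc n) = kalman_cov_step s2 (f n) (kalman_cov \<Sigma>w s2 f n)"

(* H_n *)
definition kalman_gain ::
    "('e::real_inner \<Rightarrow>\<^sub>L 'e) \<Rightarrow> real \<Rightarrow> (nat \<Rightarrow> 'e) \<Rightarrow> nat \<Rightarrow> real \<Rightarrow>\<^sub>L 'e"
  where "kalman_gain \<Sigma>w s2 f n =
    inverse s2 *\<^sub>R (kalman_cov \<Sigma>w s2 f (Suc n) o\<^sub>L col_op (f n))"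

primrec kalman_state ::
    "('e::real_inner \<Rightarrow>\<^sub>L 'e) \<Rightarrow> real \<Rightarrow> (nat \<Rightarrow> 'e) \<Rightarrow> (nat \<Rightarrow> real) \<Rightarrow> nat \<Rightarrow> 'e"
  where
    "kalman_state \<Sigma>w s2 f y 0 = 0"
  | "kalman_state \<Sigma>w s2 f y (Suc n) =
      (let v = kalman_state \<Sigma>w s2 f y n
       in v + kalman_gain \<Sigma>w s2 f n (y n - row_op (f n) v))"

(* w^\<dagger>_k *)
definition kalman_estimate ::
    "('e::real_inner \<Rightarrow>\<^sub>L 'e) \<Rightarrow> real \<Rightarrow> (nat \<Rightarrow> 'e) \<Rightarrow> (nat \<Rightarrow> real) \<Rightarrow> nat \<Rightarrow> 'e"
  where "kalman_estimate \<Sigma>w s2 f y k = kalman_state \<Sigma>w s2 f y (Suc k)"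

section \<open>OLL estimate\<close>

definition riccati_step :: "('e::real_inner \<Rightarrow>\<^sub>L 'e) \<Rightarrow> real \<Rightarrow> ('e \<Rightarrow>\<^sub>L 'e) \<Rightarrow> 'e \<Rightarrow>\<^sub>L 'e"
  where "riccati_step Q \<gamma> K = K - (K o\<^sub>L op_inv (K + \<gamma> *\<^sub>R id_blinfun) o\<^sub>L K) + Q"

(* The backward recursion for k = N, N-1, ..., 0; only the values for k \<le> N are meaningful. *)
definition riccati :: "('e::real_inner \<Rightarrow>\<^sub>L 'e) \<Rightarrow> real \<Rightarrow> nat \<Rightarrow> nat \<Rightarrow> 'e \<Rightarrow>\<^sub>L 'e"
  where "riccati Q \<gamma> N k = (riccati_step Q \<gamma> ^^ (N - k)) Q"

definition oll_gain :: "('e::real_inner \<Rightarrow>\<^sub>L 'e) \<Rightarrow> real \<Rightarrow> nat \<Rightarrow> nat \<Rightarrow> 'e \<Rightarrow>\<^sub>L 'e"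
  where "oll_gain Q \<gamma> N k =
    - (op_inv (riccati Q \<gamma> N (Suc k) + \<gamma> *\<^sub>R id_blinfun) o\<^sub>L riccati Q \<gamma> N (Suc k))"

(* v k is the Kalman-filter estimate at time k. *)
primrec oll_recursion ::
    "('e::real_inner \<Rightarrow>\<^sub>L 'e) \<Rightarrow> real \<Rightarrow> nat \<Rightarrow> (nat \<Rightarrow> 'e) \<Rightarrow> nat \<Rightarrow> 'e"
  where
    "oll_recursion Q \<gamma> N v 0 = 0"
  | "oll_recursion Q \<gamma> N v (Suc k) =
      oll_recursion Q \<gamma> N v k + oll_gain Q \<gamma> N k (oll_recursion Q \<gamma> N v k - v k)"

definition oll_estimate ::
    "('e::real_inner \<Rightarrow>\<^sub>L 'e) \<Rightarrow> real \<Rightarrow> nat \<Rightarrow> ('e \<Rightarrow>\<^sub>L 'e) \<Rightarrow> real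
      \<Rightarrow> (nat \<Rightarrow> 'e) \<Rightarrow> (nat \<Rightarrow> real) \<Rightarrow> nat \<Rightarrow> 'e"
  where "oll_estimate Q \<gamma> N \<Sigma>w s2 f y = oll_recursion Q \<gamma> N (kalman_estimate \<Sigma>w s2 f y)"

definition empirical_second_moment ::
    "('x \<Rightarrow> 'e::real_inner) \<Rightarrow> nat \<Rightarrow> (nat \<Rightarrow> 'x) \<Rightarrow> 'e \<Rightarrow>\<^sub>L 'e"
  where "empirical_second_moment \<phi> l xt =
    (1 / real l) *\<^sub>R (\<Sum>j = 1..l. outer (\<phi> (xt j)) (\<phi> (xt j)))"

end

theory Submission
  imports Defs
begin

text \<open>Both parts rest on the shape of the Riccati operators \<open>K\<close>. If \<open>Q = q I\<close> then every \<open>K\<close> is a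
  positive multiple of the identity, so the gains are scalars, and the Kalman estimates stay in the span
  of the past features because the posterior covariance differs from the prior \<open>\<nu> I\<close> by an operator
  with range in that span. In general every \<open>K\<close> is monotone, so \<open>K + \<gamma> I\<close> is invertible (Lax-Milgram),
  and \<open>u = (K + \<gamma> I)\<^sup>-\<^sup>1 K v\<close> satisfies \<open>\<gamma> u = K (v - u)\<close>; hence every increment lies in the range
  of \<open>K\<close>, which for the empirical second moment is inside the span of the unsupervised features.\<close>

section \<open>Linear combinations\<close>

text \<open>Coefficients are indexed by \<open>A\<close>, not by the image, because \<open>f\<close>
  may take equal values at several indices. Removing one index at a time avoids choosing
  representatives.\<close>

lemma in_span_image_imp_sum:
  fixes f :: "'b \<Rightarrow> 'e::real_vector"
  assumes "finite A" and "v \<in> span (f ` A)"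
  shows "\<exists>c. v = (\<Sum>j\<in>A. c j *\<^sub>R f j)"
  using assms
proof (induction A arbitrary: v rule: finite_induct)
  case empty
  then show ?case by simp
next
  case (insert a A)
  then obtain k where "v - k *\<^sub>R f a \<in> span (f ` A)"
    by (auto simp: span_breakdown_eq)
  with insert.IH obtain c where c: "v - k *\<^sub>R f a = (\<Sum>j\<in>A. c j *\<^sub>R f j)"
    by blast
  have "(\<Sum>j\<in>A. (c(a := k)) j *\<^sub>R f j) = (\<Sum>j\<in>A. c j *\<^sub>R f j)"
    using insert.hyps by (intro sum.cong) auto
  then have "v = (\<Sum>j\<in>insert a A. (c(a := k)) j *\<^sub>R f j)"
    using insert.hyps by (simp add: c[symmetric])
  then show ?case by blast
qed

text \<open>Turns span membership into both forms of the conclusion. The kernel expansion is the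
  inner product of the vector expansion with \<open>\<phi> z\<close>, so one \<open>c\<close> serves
  all \<open>z\<close>.\<close>

lemma span_features_representation:
  fixes \<phi> :: "'x \<Rightarrow> 'e::real_inner"
  assumes "finite A" and "v \<in> span ((\<lambda>j. \<phi> (p j)) ` A)"
  shows "(\<exists>c. v = (\<Sum>j\<in>A. c j *\<^sub>R \<phi> (p j))) \<and>
    (\<exists>c. \<forall>z. v \<bullet> \<phi> z = (\<Sum>j\<in>A. c j * feature_kernel \<phi> (p j) z))"
proof -
  obtain c where c: "v = (\<Sum>j\<in>A. c j *\<^sub>R \<phi> (p j))"
    using in_span_image_imp_sum[OF assms] by blast
  have "v \<bullet> \<phi> z = (\<Sum>j\<in>A. c j * feature_kernel \<phi> (p j) z)" for z
    by (simp add: c inner_sum_left feature_kernel_def)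
  with c show ?thesis by blast
qed

lemma span_image_lessThan_Suc:
  "v \<in> span (f ` {..<n}) \<Longrightarrow> v \<in> span (f ` {..<Suc n})"
  by (rule subsetD[OF span_mono]) auto

section \<open>Inverses of operators\<close>

text \<open>Two-sided inverses are unique, \<open>C = C (A B) = (C A) B = B\<close>, so the definite
  description in \<open>op_inv\<close> denotes any inverse that can be exhibited.\<close>

lemma op_inv_eqI:
  assumes "A o\<^sub>L B = id_blinfun" and "B o\<^sub>L A = id_blinfun"
  shows "op_inv A = B"
  unfolding op_inv_def
proof (rule the_equality)
  show "A o\<^sub>L B = id_blinfun \<and> B o\<^sub>L A = id_blinfun"
    using assms by blast
next
  fix C assume C: "A o\<^sub>L C = id_blinfun \<and> C o\<^sub>L A = id_blinfun"
  show "C = B"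
  proof (rule blinfun_eqI)
    fix v
    have "C v = C (A (B v))"
      using assms(1) by (metis blinfun_apply_blinfun_compose id_blinfun.rep_eq id_apply)
    also have "\<dots> = B v"
      using C by (metis blinfun_apply_blinfun_compose id_blinfun.rep_eq id_apply)
    finally show "C v = B v" .
  qed
qed

lemma op_inv_scaleR_id:
  fixes c :: real
  assumes "c \<noteq> 0"
  shows "op_inv (c *\<^sub>R (id_blinfun :: 'e::real_normed_vector \<Rightarrow>\<^sub>L 'e)) = (1 / c) *\<^sub>R id_blinfun"
  using assms by (intro op_inv_eqI blinfun_eqI) (auto simp: blinfun.scaleR_left)

text \<open>The solution of \<open>A v = b\<close> is the fixed point of \<open>v \<mapsto> v - (\<alpha> / C\<^sup>2) (A v - b)\<close>, a
  contraction for \<open>C \<ge> norm A\<close>.\<close>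

lemma coercive_surj:
  fixes A :: "'e::{real_inner, banach} \<Rightarrow>\<^sub>L 'e"
  assumes "\<alpha> > 0" and coercive: "\<And>v. \<alpha> * (norm v)\<^sup>2 \<le> A v \<bullet> v"
  shows "\<exists>v. A v = b"
proof -
  \<comment> \<open>The summand \<alpha> ensures \<open>C > 0\<close> and
    \<open>\<alpha> \<le> C\<close> even if \<open>norm A = 0\<close>, which happens in the trivial
    space.\<close>
  define C where "C = norm A + \<alpha>"
  define \<rho> where "\<rho> = \<alpha> / C\<^sup>2"
  \<comment> \<open>The squared contraction factor is 1 - 2 \<rho> \<alpha> + \<rho>^2 C^2. It is
    minimal at \<rho> = \<alpha> / C^2, with value 1 - (\<alpha> / C)^2.\<close>
  define c where "c = sqrt (1 - (\<alpha> / C)\<^sup>2)"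
  define T where "T = (\<lambda>v. v - \<rho> *\<^sub>R (A v - b))"
  have C: "C > 0" "\<alpha> \<le> C" "norm A \<le> C"
    using \<open>\<alpha> > 0\<close> by (auto simp: C_def intro: add_nonneg_pos)
  have \<rho>: "\<rho> > 0" using C \<open>\<alpha> > 0\<close> by (simp add: \<rho>_def)
  have ratio: "0 < (\<alpha> / C)\<^sup>2" "(\<alpha> / C)\<^sup>2 \<le> 1"
    using C \<open>\<alpha> > 0\<close> by (auto intro!: power_le_one)
  have c: "0 \<le> c" "c < 1" "c\<^sup>2 = 1 - (\<alpha> / C)\<^sup>2"
    using ratio by (auto simp: c_def)
  have contr: "dist (T u) (T v) \<le> c * dist u v" for u v
  proof -
    define d where "d = u - v"
    have Ad: "norm (A d) \<le> C * norm d"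
      using norm_blinfun[of A d] C mult_right_mono[OF C(3), of "norm d"] by simp
    have "(norm (d - \<rho> *\<^sub>R A d))\<^sup>2 = (norm d)\<^sup>2 - 2 * \<rho> * (A d \<bullet> d) + \<rho>\<^sup>2 * (norm (A d))\<^sup>2"
      unfolding power2_norm_eq_inner
      by (simp add: inner_diff inner_commute power2_eq_square algebra_simps)
    also have "\<dots> \<le> (norm d)\<^sup>2 - 2 * \<rho> * (\<alpha> * (norm d)\<^sup>2) + \<rho>\<^sup>2 * (C * norm d)\<^sup>2"
      using \<rho> coercive[of d] power_mono[OF Ad, of 2]
      by (intro add_mono diff_mono mult_left_mono) auto
    also have "\<dots> = (c * norm d)\<^sup>2"
      using C unfolding power_mult_distrib c(3)
      by (simp add: \<rho>_def field_simps power2_eq_square)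
    finally have "norm (d - \<rho> *\<^sub>R A d) \<le> c * norm d"
      using c by (meson mult_nonneg_nonneg norm_ge_zero power2_le_imp_le)
    moreover have "T u - T v = d - \<rho> *\<^sub>R A d"
      by (simp add: T_def d_def blinfun.diff_right algebra_simps)
    ultimately show ?thesis by (simp add: dist_norm d_def)
  qed
  have "\<exists>!v. T v = v"
    using c contr by (intro banach_fix_type) auto
  then obtain v where "T v = v" by blast
  then have "A v = b" using \<rho> by (simp add: T_def)
  then show ?thesis by blast
qed

text \<open>By Cauchy-Schwarz, coercivity bounds \<open>norm (A v)\<close> below by
  \<open>\<alpha> * norm v\<close>. This gives injectivity and the bound 1 / \<alpha> for the
  inverse map, which exists by \<open>coercive_surj\<close> and inherits linearity through
  injectivity.\<close>

lemma coercive_op_inv: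
  fixes A :: "'e::{real_inner, banach} \<Rightarrow>\<^sub>L 'e"
  assumes "\<alpha> > 0" and coercive: "\<And>v. \<alpha> * (norm v)\<^sup>2 \<le> A v \<bullet> v"
  shows "A (op_inv A v) = v" and "op_inv A (A v) = v"
proof -
  have below: "\<alpha> * norm v \<le> norm (A v)" for v
  proof (cases "v = 0")
    case False
    have "(\<alpha> * norm v) * norm v \<le> norm (A v) * norm v"
      using coercive[of v] norm_cauchy_schwarz[of "A v" v] by (simp add: power2_eq_square)
    then show ?thesis using False by simp
  qed simp
  have inj: "u = v" if "A u = A v" for u v
    using below[of "u - v"] that \<open>\<alpha> > 0\<close> by (simp add: blinfun.diff_right mult_le_0_iff)
  define g where "g = inv (blinfun_apply A)"
  have Ag: "A (g v) = v" for v
    unfolding g_def using coercive_surj[OF assms, of v] by (metis f_inv_into_f rangeI)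
  have "bounded_linear g"
  proof (rule bounded_linear_intro)
    show "g (u + v) = g u + g v" for u v
      by (rule inj) (simp add: Ag blinfun.add_right)
    show "g (r *\<^sub>R v) = r *\<^sub>R g v" for r v
      by (rule inj) (simp add: Ag blinfun.scaleR_right)
    show "norm (g v) \<le> norm v * (1 / \<alpha>)" for v
      using below[of "g v"] \<open>\<alpha> > 0\<close> by (simp add: Ag field_simps)
  qed
  then have B: "blinfun_apply (Blinfun g) = g" by (rule bounded_linear_Blinfun_apply)
  have "op_inv A = Blinfun g"
    by (rule op_inv_eqI; rule blinfun_eqI) (auto simp: B Ag intro: inj)
  then show "A (op_inv A v) = v" and "op_inv A (A v) = v"
    by (auto simp: B Ag intro: inj)
qed

section \<open>The Kalman filter with isotropic prior\<close>

text \<open>Each update subtracts an operator with range in the line through \<Sigma> (f n), and by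
  induction that vector is \<nu> times \<open>f n\<close> plus a combination of earlier features.
  Owing to the index shift, stage \<open>n\<close> has seen exactly \<open>f 0\<close>, ...,
  \<open>f (n - 1)\<close>.\<close>

lemma kalman_cov_isotropic_span:
  fixes f :: "nat \<Rightarrow> 'e::real_inner"
  shows "kalman_cov (\<nu> *\<^sub>R id_blinfun) s2 f n v - \<nu> *\<^sub>R v \<in> span (f ` {..<n})"
proof (induction n arbitrary: v)
  case 0
  show ?case by (simp add: blinfun.scaleR_left span_zero)
next
  case (Suc n)
  let ?\<Sigma> = "kalman_cov (\<nu> *\<^sub>R id_blinfun) s2 f n"
  have "?\<Sigma> (f n) - \<nu> *\<^sub>R f n + \<nu> *\<^sub>R f n \<in> span (f ` {..<Suc n})"
    by (intro span_add span_image_lessThan_Suc[OF Suc.IH] span_scale span_base) auto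
  \<comment> \<open>Applied to \<open>v\<close>, the update subtracts a scalar multiple of
    \<open>?\<Sigma> (f n)\<close>. Keeping \<open>r\<close> general avoids any computation with the
    inverse innovation variance.\<close>
  then have "?\<Sigma> v - \<nu> *\<^sub>R v - r *\<^sub>R ?\<Sigma> (f n) \<in> span (f ` {..<Suc n})" for r
    by (intro span_diff span_image_lessThan_Suc[OF Suc.IH] span_scale) simp
  then show ?case
    by (simp add: kalman_cov_step_def blinfun.diff_left blinfun.scaleR_left
        blinfun.scaleR_right algebra_simps)
qed

lemma kalman_state_isotropic_span:
  fixes f :: "nat \<Rightarrow> 'e::real_inner"
  shows "kalman_state (\<nu> *\<^sub>R id_blinfun) s2 f y n \<in> span (f ` {..<n})"
proof (induction n)
  case 0
  show ?case by (simp add: span_zero)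
next
  case (Suc n)
  let ?\<Sigma> = "kalman_cov (\<nu> *\<^sub>R id_blinfun) s2 f (Suc n)"
  let ?v = "kalman_state (\<nu> *\<^sub>R id_blinfun) s2 f y n"
  have v: "?v \<in> span (f ` {..<Suc n})"
    using Suc.IH by (rule span_image_lessThan_Suc)
  have "?\<Sigma> (f n) - \<nu> *\<^sub>R f n + \<nu> *\<^sub>R f n \<in> span (f ` {..<Suc n})"
    by (intro span_add kalman_cov_isotropic_span span_scale span_base) auto
  then have \<Sigma>: "?\<Sigma> (f n) \<in> span (f ` {..<Suc n})"
    by simp
  \<comment> \<open>The correction is a multiple of the updated covariance applied to
    \<open>f n\<close>. That covariance must stay folded so that the span fact just obtained
    applies.\<close>
  have "kalman_state (\<nu> *\<^sub>R id_blinfun) s2 f y (Suc n) =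
      ?v + (inverse s2 * (y n - f n \<bullet> ?v)) *\<^sub>R ?\<Sigma> (f n)"
    by (simp add: Let_def kalman_gain_def blinfun.scaleR_left blinfun.scaleR_right
        del: kalman_cov.simps)
  then show ?case
    using v \<Sigma> by (simp only:) (intro span_add span_scale)
qed

section \<open>Isotropic inputs\<close>

lemma riccati_isotropic:
  assumes "q > 0" and "\<gamma> > 0"
  shows "\<exists>\<kappa>>0. riccati (q *\<^sub>R (id_blinfun :: 'e::real_inner \<Rightarrow>\<^sub>L 'e)) \<gamma> N k = \<kappa> *\<^sub>R id_blinfun"
proof -
  let ?Q = "q *\<^sub>R (id_blinfun :: 'e \<Rightarrow>\<^sub>L 'e)"
  have "\<exists>\<kappa>>0. (riccati_step ?Q \<gamma> ^^ n) ?Q = \<kappa> *\<^sub>R id_blinfun" for n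
  proof (induction n)
    case 0
    then show ?case using \<open>q > 0\<close> by auto
  next
    case (Suc n)
    then obtain \<kappa> where \<kappa>: "\<kappa> > 0" "(riccati_step ?Q \<gamma> ^^ n) ?Q = \<kappa> *\<^sub>R id_blinfun"
      by blast
    define \<kappa>' where "\<kappa>' = \<kappa> - \<kappa> * \<kappa> / (\<kappa> + \<gamma>) + q"
    \<comment> \<open>This form of the scalar Riccati map shows positivity, which in turn keeps
      \<open>\<kappa> + \<gamma>\<close> nonzero in the next inversion.\<close>
    have "\<kappa>' = \<kappa> * \<gamma> / (\<kappa> + \<gamma>) + q"
      using \<kappa>(1) \<open>\<gamma> > 0\<close> by (simp add: \<kappa>'_def field_simps)
    then have "\<kappa>' > 0"
      using \<kappa>(1) assms by (simp add: add_pos_pos)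
    have sum: "\<kappa> *\<^sub>R id_blinfun + \<gamma> *\<^sub>R id_blinfun = (\<kappa> + \<gamma>) *\<^sub>R (id_blinfun :: 'e \<Rightarrow>\<^sub>L 'e)"
      by (simp add: scaleR_add_left)
    have inv: "op_inv ((\<kappa> + \<gamma>) *\<^sub>R (id_blinfun :: 'e \<Rightarrow>\<^sub>L 'e)) = (1 / (\<kappa> + \<gamma>)) *\<^sub>R id_blinfun"
      using \<kappa>(1) \<open>\<gamma> > 0\<close> by (intro op_inv_scaleR_id) auto
    have "riccati_step ?Q \<gamma> (\<kappa> *\<^sub>R id_blinfun) = \<kappa>' *\<^sub>R id_blinfun"
      unfolding riccati_step_def sum inv
      by (rule blinfun_eqI)
        (simp add: \<kappa>'_def blinfun.add_left blinfun.diff_left blinfun.scaleR_left scaleR_add_left scaleR_diff_left)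
    with \<open>\<kappa>' > 0\<close> show ?case by (auto simp: \<kappa>(2))
  qed
  then show ?thesis by (simp add: riccati_def)
qed

lemma oll_gain_isotropic:
  assumes "q > 0" and "\<gamma> > 0"
  shows "\<exists>c. oll_gain (q *\<^sub>R (id_blinfun :: 'e::real_inner \<Rightarrow>\<^sub>L 'e)) \<gamma> N k = c *\<^sub>R id_blinfun"
proof -
  obtain \<kappa> where \<kappa>: "\<kappa> > 0"
    "riccati (q *\<^sub>R (id_blinfun :: 'e \<Rightarrow>\<^sub>L 'e)) \<gamma> N (Suc k) = \<kappa> *\<^sub>R id_blinfun"
    using riccati_isotropic[OF assms] by blast
  have "op_inv ((\<kappa> + \<gamma>) *\<^sub>R (id_blinfun :: 'e \<Rightarrow>\<^sub>L 'e)) = (1 / (\<kappa> + \<gamma>)) *\<^sub>R id_blinfun"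
    using \<kappa>(1) \<open>\<gamma> > 0\<close> by (intro op_inv_scaleR_id) auto
  then have "oll_gain (q *\<^sub>R (id_blinfun :: 'e \<Rightarrow>\<^sub>L 'e)) \<gamma> N k = (- \<kappa> / (\<kappa> + \<gamma>)) *\<^sub>R id_blinfun"
    unfolding oll_gain_def \<kappa>(2)
    by (intro blinfun_eqI) (simp add: scaleR_add_left[symmetric] blinfun.scaleR_left blinfun.minus_left)
  then show ?thesis by blast
qed

lemma oll_estimate_isotropic_span:
  fixes f :: "nat \<Rightarrow> 'e::real_inner"
  assumes "q > 0" and "\<gamma> > 0"
  shows "oll_estimate (q *\<^sub>R id_blinfun) \<gamma> N (\<nu> *\<^sub>R id_blinfun) s2 f y k \<in> span (f ` {..<k})"
  unfolding oll_estimate_def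
proof (induction k)
  case 0
  show ?case by (simp add: span_zero)
next
  case (Suc k)
  let ?v = "kalman_estimate (\<nu> *\<^sub>R id_blinfun) s2 f y"
  let ?o = "oll_recursion (q *\<^sub>R id_blinfun) \<gamma> N ?v"
  obtain c where c: "oll_gain (q *\<^sub>R (id_blinfun :: 'e \<Rightarrow>\<^sub>L 'e)) \<gamma> N k = c *\<^sub>R id_blinfun"
    using oll_gain_isotropic[OF assms] by blast
  have o: "?o k \<in> span (f ` {..<Suc k})"
    using Suc.IH by (rule span_image_lessThan_Suc)
  \<comment> \<open>The estimate at time \<open>k\<close> is \<open>kalman_state\<close> at
    \<open>Suc k\<close>, so it already involves \<open>f k\<close>; it enters the OLL estimate only
    at \<open>Suc k\<close>, which matches the enlarged span.\<close>
  have v: "?v k \<in> span (f ` {..<Suc k})"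
    unfolding kalman_estimate_def by (rule kalman_state_isotropic_span)
  have "?o (Suc k) = ?o k + c *\<^sub>R (?o k - ?v k)"
    by (simp add: c blinfun.scaleR_left)
  then show ?case
    using o v by (simp only:) (intro span_add span_scale span_diff)
qed

section \<open>Inputs with a monotone second moment\<close>

text \<open>Monotonicity of \<open>K\<close> makes the shifted operator coercive with constant
  \<gamma>. The two equations are its right and left inverse laws, expanded.\<close>

lemma op_inv_shift:
  fixes K :: "'e::{real_inner, banach} \<Rightarrow>\<^sub>L 'e"
  assumes "\<gamma> > 0" and "\<And>v. 0 \<le> K v \<bullet> v"
  shows "K (op_inv (K + \<gamma> *\<^sub>R id_blinfun) v) + \<gamma> *\<^sub>R op_inv (K + \<gamma> *\<^sub>R id_blinfun) v = v"
    and "op_inv (K + \<gamma> *\<^sub>R id_blinfun) (K v) + \<gamma> *\<^sub>R op_inv (K + \<gamma> *\<^sub>R id_blinfun) v = v"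
proof -
  have "\<gamma> * (norm v)\<^sup>2 \<le> (K + \<gamma> *\<^sub>R id_blinfun) v \<bullet> v" for v
    using assms(2)[of v]
    by (simp add: blinfun.add_left blinfun.scaleR_left inner_add_left power2_norm_eq_inner)
  note inv = coercive_op_inv[OF \<open>\<gamma> > 0\<close> this, of v]
  show "K (op_inv (K + \<gamma> *\<^sub>R id_blinfun) v) + \<gamma> *\<^sub>R op_inv (K + \<gamma> *\<^sub>R id_blinfun) v = v"
    using inv(1) by (simp add: blinfun.add_left blinfun.scaleR_left)
  show "op_inv (K + \<gamma> *\<^sub>R id_blinfun) (K v) + \<gamma> *\<^sub>R op_inv (K + \<gamma> *\<^sub>R id_blinfun) v = v"
    using inv(2) by (simp add: blinfun.add_left blinfun.scaleR_left blinfun.add_right blinfun.scaleR_right)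
qed

text \<open>With s = (K + \<gamma> I)^-1 v, the step without Q sends v to \<gamma> K s. Pairing with
  v = K s + \<gamma> s gives \<gamma> (|K s|^2 + \<gamma> (K s, s)), which is nonnegative.\<close>

lemma riccati_step_monotone:
  fixes K Q :: "'e::{real_inner, banach} \<Rightarrow>\<^sub>L 'e"
  assumes "\<gamma> > 0" and K: "\<And>v. 0 \<le> K v \<bullet> v" and Q: "\<And>v. 0 \<le> Q v \<bullet> v"
  shows "0 \<le> riccati_step Q \<gamma> K v \<bullet> v"
proof -
  define s where "s = op_inv (K + \<gamma> *\<^sub>R id_blinfun) v"
  have v: "K s + \<gamma> *\<^sub>R s = v" and RK: "op_inv (K + \<gamma> *\<^sub>R id_blinfun) (K v) = v - \<gamma> *\<^sub>R s"
    using op_inv_shift[OF assms(1,2), of v] by (auto simp: s_def algebra_simps)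
  have "riccati_step Q \<gamma> K v = \<gamma> *\<^sub>R K s + Q v"
    by (simp add: riccati_step_def blinfun.add_left blinfun.diff_left blinfun.diff_right
        blinfun.scaleR_right RK)
  moreover have "K s \<bullet> v = K s \<bullet> K s + \<gamma> * (K s \<bullet> s)"
    using v by (metis inner_add_right inner_scaleR_right)
  ultimately show ?thesis
    using assms(1) K[of s] Q[of v] by (simp add: inner_add_left)
qed

text \<open>The range is preserved because the outermost operator in every term of the Riccati step
  is \<open>K\<close> or \<open>Q\<close>.\<close>

lemma riccati_monotone_range:
  fixes Q :: "'e::{real_inner, banach} \<Rightarrow>\<^sub>L 'e"
  assumes "\<gamma> > 0" and "\<And>v. 0 \<le> Q v \<bullet> v" and "subspace S" and "\<And>v. Q v \<in> S"
  shows "0 \<le> riccati Q \<gamma> N k v \<bullet> v" and "riccati Q \<gamma> N k v \<in> S"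
proof -
  have "(\<forall>v. 0 \<le> (riccati_step Q \<gamma> ^^ n) Q v \<bullet> v) \<and> (\<forall>v. (riccati_step Q \<gamma> ^^ n) Q v \<in> S)" for n
  proof (induction n)
    case 0
    then show ?case using assms by simp
  next
    case (Suc n)
    define K where "K = (riccati_step Q \<gamma> ^^ n) Q"
    note IH = Suc.IH[folded K_def]
    have "riccati_step Q \<gamma> K v \<in> S" for v
      using IH assms(3,4)
      by (auto simp: riccati_step_def blinfun.add_left blinfun.diff_left
          intro!: subspace_add subspace_diff)
    moreover have "0 \<le> riccati_step Q \<gamma> K v \<bullet> v" for v
      using IH assms by (intro riccati_step_monotone) auto
    ultimately show ?case by (simp add: K_def)
  qed
  then show "0 \<le> riccati Q \<gamma> N k v \<bullet> v" and "riccati Q \<gamma> N k v \<in> S"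
    by (auto simp: riccati_def)
qed

text \<open>The sequence \<open>v\<close> is arbitrary: it enters an increment only through
  \<open>?K u\<close>, so the filter estimates themselves may lie outside \<open>S\<close>.\<close>

lemma oll_recursion_range:
  fixes Q :: "'e::{real_inner, banach} \<Rightarrow>\<^sub>L 'e"
  assumes "\<gamma> > 0" and "\<And>v. 0 \<le> Q v \<bullet> v" and "subspace S" and "\<And>v. Q v \<in> S"
  shows "oll_recursion Q \<gamma> N v k \<in> S"
proof (induction k)
  case 0
  show ?case using assms(3) by (simp add: subspace_0)
next
  case (Suc k)
  let ?K = "riccati Q \<gamma> N (Suc k)"
  define u where "u = oll_recursion Q \<gamma> N v k - v k"
  define s where "s = op_inv (?K + \<gamma> *\<^sub>R id_blinfun) (?K u)"
  have "?K s + \<gamma> *\<^sub>R s = ?K u"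
    unfolding s_def by (rule op_inv_shift(1)[OF assms(1) riccati_monotone_range(1)[OF assms]])
  \<comment> \<open>In the gain the inverse is outermost, so its range is not visible directly;
    solving the defining equation of \<open>s\<close> for \<open>s\<close> exhibits it as a value of
    \<open>?K\<close>, up to scaling.\<close>
  then have "\<gamma> *\<^sub>R s = ?K u - ?K s" by (simp add: algebra_simps)
  then have "s = (1 / \<gamma>) *\<^sub>R (?K u - ?K s)"
    using assms(1) by (metis less_irrefl divideR_right inverse_eq_divide)
  also have "\<dots> \<in> S"
    by (intro subspace_scale subspace_diff assms(3) riccati_monotone_range(2)[OF assms])
  finally have "s \<in> S" .
  moreover have "oll_recursion Q \<gamma> N v (Suc k) = oll_recursion Q \<gamma> N v k - s"
    by (simp add: oll_gain_def s_def u_def blinfun.minus_left)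
  ultimately show ?case
    using Suc.IH assms(3) by (simp add: subspace_diff)
qed

lemma empirical_second_moment_apply:
  "empirical_second_moment \<phi> l xt v =
    (1 / real l) *\<^sub>R (\<Sum>j = 1..l. (\<phi> (xt j) \<bullet> v) *\<^sub>R \<phi> (xt j))"
  by (simp add: empirical_second_moment_def outer_def blinfun.scaleR_left blinfun.sum_left)

text \<open>The quadratic form of the empirical moment is an average of squares, and its values are
  combinations of the unsupervised features, so \<open>oll_recursion_range\<close> applies with
  their span as \<open>S\<close>.\<close>

lemma oll_estimate_empirical_span:
  fixes \<phi> :: "'x \<Rightarrow> 'e::{real_inner, banach}"
  assumes "\<gamma> > 0"
  shows "oll_estimate (empirical_second_moment \<phi> l xt) \<gamma> N \<Sigma>w s2 f y k
    \<in> span ((\<lambda>j. \<phi> (xt j)) ` {1..l})"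
  unfolding oll_estimate_def
proof (rule oll_recursion_range[OF assms])
  show "0 \<le> empirical_second_moment \<phi> l xt v \<bullet> v" for v
    by (simp add: empirical_second_moment_apply inner_sum_left sum_nonneg)
  show "empirical_second_moment \<phi> l xt v \<in> span ((\<lambda>j. \<phi> (xt j)) ` {1..l})" for v
    unfolding empirical_second_moment_apply by (intro span_scale span_sum span_base) auto
qed (rule subspace_span)

theorem proposition10:
  fixes M :: "'a measure"
    and \<phi> :: "real^'d \<Rightarrow> 'e::{real_inner, banach}"
    and x :: "nat \<Rightarrow> 'a \<Rightarrow> real^'d"
    and w :: "'a \<Rightarrow> 'e \<Rightarrow> real"
    and \<epsilon> y :: "nat \<Rightarrow> 'a \<Rightarrow> real"
    and N :: nat
    and \<gamma> \<sigma>\<epsilon>2 \<nu> :: real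
    and \<Sigma>w Qbar :: "'e \<Rightarrow>\<^sub>L 'e"
    and what :: "nat \<Rightarrow> 'a \<Rightarrow> 'e"
  assumes model: "kernel_online_learning M \<phi> x w \<epsilon> y N \<gamma> \<sigma>\<epsilon>2 \<Sigma>w Qbar"
    and weight_gaussian: "\<And>a. gaussian_variable M (\<lambda>\<omega>. w \<omega> a)"
    and noise_gaussian: "\<And>k. k \<le> N \<Longrightarrow> gaussian_variable M (\<epsilon> k)"
    and prior: "\<nu> > 0" "\<Sigma>w = \<nu> *\<^sub>R id_blinfun"
    and what_def: "\<And>k \<omega>. what k \<omega> =
      oll_estimate Qbar \<gamma> N \<Sigma>w \<sigma>\<epsilon>2 (\<lambda>j. \<phi> (x j \<omega>)) (\<lambda>j. y j \<omega>) k"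
  shows
    "(\<forall>q>0. Qbar = q *\<^sub>R id_blinfun \<longrightarrow>
        (\<forall>k\<le>N. \<forall>\<omega>\<in>space M.
          (\<exists>c. what k \<omega> = (\<Sum>j<k. c j *\<^sub>R \<phi> (x j \<omega>))) \<and>
          (\<exists>c. \<forall>z. what k \<omega> \<bullet> \<phi> z = (\<Sum>j<k. c j * feature_kernel \<phi> (x j \<omega>) z)))) \<and>
     (\<forall>l>0. \<forall>xt. Qbar = empirical_second_moment \<phi> l xt \<longrightarrow>
        (\<forall>k\<le>N. \<forall>\<omega>\<in>space M.
          (\<exists>c. what k \<omega> = (\<Sum>j = 1..l. c j *\<^sub>R \<phi> (xt j))) \<and>
          (\<exists>c. \<forall>z. what k \<omega> \<bullet> \<phi> z = (\<Sum>j = 1..l. c j * feature_kernel \<phi> (xt j) z))))"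
proof (intro conjI allI impI ballI)
  have \<gamma>: "\<gamma> > 0"
    using model by (rule kernel_online_learning.penalty)
  {
    \<comment> \<open>The claim is pathwise: for fixed \<omega> the recursions are deterministic in
      the realized data, and the coefficients may vary with \<omega>.\<close>
    fix q :: real and k \<omega>
    assume "q > 0" "Qbar = q *\<^sub>R id_blinfun"
    then have "what k \<omega> \<in> span ((\<lambda>j. \<phi> (x j \<omega>)) ` {..<k})"
      unfolding what_def prior(2) using oll_estimate_isotropic_span[OF _ \<gamma>] by blast
    note * = span_features_representation[where \<phi> = \<phi> and p = "\<lambda>j. x j \<omega>", OF finite_lessThan this]
    show "\<exists>c. what k \<omega> = (\<Sum>j<k. c j *\<^sub>R \<phi> (x j \<omega>))"
      using * by blast
    show "\<exists>c. \<forall>z. what k \<omega> \<bullet> \<phi> z = (\<Sum>j<k. c j * feature_kernel \<phi> (x j \<omega>) z)"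
      using * by blast
  }
  {
    \<comment> \<open>Here the spanning vectors are the same for all \<omega>; randomness enters
      only through the coefficients.\<close>
    fix l k :: nat and xt \<omega>
    assume "Qbar = empirical_second_moment \<phi> l xt"
    then have "what k \<omega> \<in> span ((\<lambda>j. \<phi> (xt j)) ` {1..l})"
      unfolding what_def using oll_estimate_empirical_span[OF \<gamma>] by blast
    note * = span_features_representation[where \<phi> = \<phi> and p = xt, OF finite_atLeastAtMost this]
    show "\<exists>c. what k \<omega> = (\<Sum>j = 1..l. c j *\<^sub>R \<phi> (xt j))"
      using * by blast
    show "\<exists>c. \<forall>z. what k \<omega> \<bullet> \<phi> z = (\<Sum>j = 1..l. c j * feature_kernel \<phi> (xt j) z)"
      using * by blast
  }
qed

end
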